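(* Let $k$ be a positive integer and let $G$ be a connected graph of order $n$ with minimum degree $\delta$. Then $$SW_k(G) \leq \frac{k-1}{k+1}\,\frac{3(n+1)}{\delta+1}\binom{n}{k} + \Big(\frac{3\delta}{\delta+1}+2k\Big)\binom{n}{k},$$ and thus (for $k\le n$, so that $\mu_k(G)$ is defined) $$\mu_k(G) \leq \frac{k-1}{k+1}\,\frac{3(n+1)}{\delta+1} + \frac{3\delta}{\delta+1}+2k.$$
   Context: All graphs are finite and simple; the order of a graph is its number of vertices. For a non-empty set $S$ of vertices of a connected graph $G$, the Steiner distance $d_G(S)$ is the minimum size (number of edges) of a connected subgraph of $G$ containing all vertices of $S$. For a positive integer $k$, the Steiner $k$-Wiener index of a connected graph $G$ is $SW_k(G)=\sum_{S\subseteq V(G),\,|S|=k} d_G(S)$. For $G$ of order $n\ge k$, the average Steiner $k$-distance is $\mu_k(G)=\binom{n}{k}^{-1}SW_k(G)$. *)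

theory Defs
  imports Complex_Main
begin

text \<open>A graph is given by its vertex set \<open>V\<close> and its set \<open>E\<close> of edges, each edge being the
  two-element set of its endpoints.\<close>

definition simple_graph :: "'a set \<Rightarrow> 'a set set \<Rightarrow> bool" where
  "simple_graph V E \<longleftrightarrow> finite V \<and> (\<forall>e\<in>E. e \<subseteq> V \<and> card e = 2)"

definition adj_rel :: "'a set set \<Rightarrow> ('a \<times> 'a) set" where
  "adj_rel E = {(u, v). {u, v} \<in> E}"

definition connected_graph :: "'a set \<Rightarrow> 'a set set \<Rightarrow> bool" where
  "connected_graph V E \<longleftrightarrow>
     simple_graph V E \<and> V \<noteq> {} \<and> (\<forall>u\<in>V. \<forall>v\<in>V. (u, v) \<in> (adj_rel E)\<^sup>*)"

definition subgraph_of :: "'a set \<Rightarrow> 'a set set \<Rightarrow> 'a set \<Rightarrow> 'a set set \<Rightarrow> bool" where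
  "subgraph_of W F V E \<longleftrightarrow> simple_graph W F \<and> W \<subseteq> V \<and> F \<subseteq> E"

definition vertex_degree :: "'a set set \<Rightarrow> 'a \<Rightarrow> nat" where
  "vertex_degree E v = card {e \<in> E. v \<in> e}"

definition min_degree :: "'a set \<Rightarrow> 'a set set \<Rightarrow> nat" where
  "min_degree V E = Min (vertex_degree E ` V)"

text \<open>The minimum below is attained whenever \<open>V\<close>, \<open>E\<close> is a connected graph and
  \<open>S \<subseteq> V\<close>, because the whole graph is then an admissible subgraph.\<close>

definition steiner_distance :: "'a set \<Rightarrow> 'a set set \<Rightarrow> 'a set \<Rightarrow> nat" where
  "steiner_distance V E S =
     (LEAST m. \<exists>W F. subgraph_of W F V E \<and> connected_graph W F \<and> S \<subseteq> W \<and> card F = m)"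

definition steiner_wiener :: "nat \<Rightarrow> 'a set \<Rightarrow> 'a set set \<Rightarrow> nat" where
  "steiner_wiener k V E = (\<Sum>S | S \<subseteq> V \<and> card S = k. steiner_distance V E S)"

definition avg_steiner_distance :: "nat \<Rightarrow> 'a set \<Rightarrow> 'a set set \<Rightarrow> real" where
  "avg_steiner_distance k V E = real (steiner_wiener k V E) / real (card V choose k)"

end

theory Submission
  imports Defs
begin

text \<open>The idea is to compare \<open>G\<close> with a weighted tree. Choose vertices \<open>a 0, \<dots>, a m\<close> with pairwise
  disjoint closed neighbourhoods, as many as possible, in such an order that every \<open>a i\<close> with
  \<open>i > 0\<close> is reached from an earlier \<open>a (p i)\<close> in at most three steps
  (\<open>maximal_nbhd_packing\<close>). The parent function \<open>p\<close> makes \<open>{0, \<dots>, m}\<close> a tree. Maximality puts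
  every vertex \<open>v\<close> of \<open>G\<close> within two steps of some \<open>a (\<pi> v)\<close>, and \<open>\<pi>\<close> can be chosen to send each of
  the packed neighbourhoods to its own centre, so every tree node receives at least \<open>D = \<delta> + 1\<close> vertices.

  A \<open>k\<close>-set \<open>S\<close> can be connected by attaching each of its vertices to its node at a cost of two
  edges and then joining the nodes through the tree, where each tree edge that separates \<open>\<pi> ` S\<close>
  costs three edges of \<open>G\<close>. Summed over \<open>S\<close>, a tree edge that splits the \<open>n\<close> vertices into
  \<open>w\<close> and \<open>n - w\<close> is charged for \<open>f w = (n choose k) - (w choose k) - (n - w choose k)\<close> sets.
  Hence \<open>SW\<^sub>k(G)\<close> is at most \<open>2 k (n choose k) + 3 \<Sum> f (w i)\<close>, with the sum over the tree edges \<open>i\<close>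
  (\<open>steiner_wiener_le_cuts\<close>).

  It remains to show \<open>D \<Sum> f (w i) \<le> (\<Sum>j=1..n-1. f j) + (D - 1) (n choose k)\<close>, where the sum on
  the right is the Steiner Wiener index of the path on \<open>n\<close> vertices, namely
  \<open>(k - 1) / (k + 1) * (n + 1) * (n choose k)\<close> (\<open>cut_count_sum\<close>). The function \<open>f\<close> is symmetric
  under \<open>w \<mapsto> n - w\<close> and increases up to \<open>n / 2\<close>, so it is a nonnegative combination of
  indicator functions of the intervals \<open>[x, n - x]\<close> (\<open>cut_count_layers\<close>), and it suffices to
  compare, for each \<open>x\<close>, the number of edges with \<open>x \<le> w i \<le> n - x\<close> to the \<open>n - 2 x + 1\<close> integers
  in that interval. If there is such an edge, contracting all others leaves a tree with at least
  two leaves, each of weight at least \<open>x\<close>, whose remaining nodes have weight at least \<open>D\<close>; so there are at most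
  \<open>(n - 2 x) / D + 1\<close> such edges (\<open>balanced_edges_bound\<close>).\<close>

section \<open>Subgraphs grown by walks\<close>

text \<open>An upper bound on the Steiner distance, kept as the existence of a witness so that a subgraph can
  be enlarged step by step.\<close>

definition spanned :: "'a set \<Rightarrow> 'a set set \<Rightarrow> 'a set \<Rightarrow> nat \<Rightarrow> bool" where
  "spanned V E S m \<longleftrightarrow>
     (\<exists>W F. subgraph_of W F V E \<and> connected_graph W F \<and> S \<subseteq> W \<and> card F \<le> m)"

lemma steiner_distance_le:
  assumes "spanned V E S m"
  shows "steiner_distance V E S \<le> m"
proof -
  from assms obtain W F where WF: "subgraph_of W F V E" "connected_graph W F" "S \<subseteq> W" "card F \<le> m"
    unfolding spanned_def by blast
  have "steiner_distance V E S \<le> card F"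
    unfolding steiner_distance_def by (rule Least_le) (use WF in blast)
  with WF show ?thesis by simp
qed

lemma spanned_mono:
  "spanned V E S m \<Longrightarrow> S' \<subseteq> S \<Longrightarrow> m \<le> m' \<Longrightarrow> spanned V E S' m'"
  unfolding spanned_def by (meson order_trans)

lemma spanned_singleton:
  assumes "v \<in> V"
  shows "spanned V E {v} 0"
  unfolding spanned_def subgraph_of_def connected_graph_def simple_graph_def
  using assms by (intro exI[of _ "{v}"] exI[of _ "{}"]) auto

text \<open>Steps are taken in the reflexive closure of adjacency, so that \<open>l\<close>-fold composition of that
  relation means a walk of length at most \<open>l\<close>.\<close>

lemma spanned_step:
  assumes G: "simple_graph V E" and S: "spanned V E S m" "u \<in> S"
    and uv: "(u, v) \<in> (adj_rel E)\<^sup>="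
  shows "spanned V E (insert v S) (Suc m)"
proof (cases "u = v")
  case True
  then show ?thesis using S by (auto intro: spanned_mono simp: insert_absorb)
next
  case False
  then have e: "{u, v} \<in> E" using uv by (auto simp: adj_rel_def)
  then have eV: "{u, v} \<subseteq> V" "card {u, v} = 2" using G unfolding simple_graph_def by blast+
  from S(1) obtain W F where WF: "subgraph_of W F V E" "connected_graph W F" "S \<subseteq> W" "card F \<le> m"
    unfolding spanned_def by blast
  let ?W = "insert v W" and ?F = "insert {u, v} F"
  let ?R = "adj_rel ?F"
  have uW: "u \<in> W" using S(2) WF(3) by blast
  have simple: "simple_graph ?W ?F"
    using WF(1) eV uW unfolding subgraph_of_def simple_graph_def by auto
  have sub: "subgraph_of ?W ?F V E"
    using WF(1) simple e eV unfolding subgraph_of_def by auto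
  have mono: "(adj_rel F)\<^sup>* \<subseteq> ?R\<^sup>*"
    by (rule rtrancl_mono) (auto simp: adj_rel_def)
  have edge: "(u, v) \<in> ?R\<^sup>*" "(v, u) \<in> ?R\<^sup>*"
    by (auto simp: adj_rel_def insert_commute)
  have to_u: "(x, u) \<in> ?R\<^sup>* \<and> (u, x) \<in> ?R\<^sup>*" if "x \<in> ?W" for x
    using that edge mono WF(2) uW unfolding connected_graph_def by blast
  have "\<forall>x\<in>?W. \<forall>y\<in>?W. (x, y) \<in> ?R\<^sup>*"
    using to_u rtrancl_trans by metis
  then have conn: "connected_graph ?W ?F"
    using simple unfolding connected_graph_def by auto
  have "card ?F \<le> Suc m"
    using WF(4) card_insert_le_m1[of "Suc m" F] by simp
  then show ?thesis
    using sub conn WF(3) unfolding spanned_def by blast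
qed

lemma spanned_walk:
  assumes G: "simple_graph V E" and S: "spanned V E S m" "u \<in> S"
  shows "(u, v) \<in> (adj_rel E)\<^sup>= ^^ l \<Longrightarrow> spanned V E (insert v S) (m + l)"
proof (induction l arbitrary: v)
  case 0
  then show ?case using S by (simp add: insert_absorb)
next
  case (Suc l)
  then obtain w where w: "(u, w) \<in> (adj_rel E)\<^sup>= ^^ l" "(w, v) \<in> (adj_rel E)\<^sup>="
    by auto
  have "spanned V E (insert v (insert w S)) (Suc (m + l))"
    using spanned_step[OF G Suc.IH[OF w(1)] _ w(2)] by simp
  then show ?case by (rule spanned_mono) auto
qed

lemma spanned_attach:
  assumes G: "simple_graph V E" and X: "spanned V E X m" and T: "finite T"
    and near: "\<And>v. v \<in> T \<Longrightarrow> \<exists>u\<in>X. (u, v) \<in> (adj_rel E)\<^sup>= ^^ l"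
  shows "spanned V E (X \<union> T) (m + l * card T)"
  using T near
proof (induction T)
  case empty
  then show ?case using X by simp
next
  case (insert v T)
  then obtain u where u: "u \<in> X" "(u, v) \<in> (adj_rel E)\<^sup>= ^^ l" by blast
  have "spanned V E (insert v (X \<union> T)) (m + l * card T + l)"
    using spanned_walk[OF G _ _ u(2)] insert u(1) by blast
  then show ?case using insert.hyps by (simp add: algebra_simps)
qed

section \<open>Rooted trees given by a parent function\<close>

text \<open>A parent function with \<open>p j < j\<close> for \<open>j > 0\<close> describes a tree rooted at \<open>0\<close>.
  An index \<open>i > 0\<close> also stands for the edge joining \<open>i\<close> to \<open>p i\<close>, whose removal cuts off
  exactly the nodes \<open>below\<close> \<open>i\<close>, among them \<open>i\<close> itself.\<close>

inductive below :: "(nat \<Rightarrow> nat) \<Rightarrow> nat \<Rightarrow> nat \<Rightarrow> bool" for p i where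
  self: "below p i i"
| child: "j > 0 \<Longrightarrow> below p i (p j) \<Longrightarrow> below p i j"

lemma below_le:
  assumes "\<And>j. j > 0 \<Longrightarrow> p j < j" and "below p i j"
  shows "i \<le> j"
  using assms(2)
proof induction
  case (child j)
  then show ?case using assms(1)[of j] by simp
qed simp

lemma below_parent_iff:
  "j > 0 \<Longrightarrow> i \<noteq> j \<Longrightarrow> below p i j \<longleftrightarrow> below p i (p j)"
  by (auto elim: below.cases intro: below.child)

text \<open>The ancestors of a node form a chain, so the subtrees are nested or disjoint.\<close>

lemma below_linear:
  assumes "below p i l" "below p j l"
  shows "below p i j \<or> below p j i"
  using assms
proof induction
  case (child l)
  show ?case
  proof (cases "j = l")
    case True
    then show ?thesis using below.child[OF child(1,2)] by simp
  next
    case False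
    then have "below p j (p l)" using child by (simp add: below_parent_iff)
    then show ?thesis by (rule child.IH)
  qed
qed blast

lemma below_trans: "below p j l \<Longrightarrow> below p i j \<Longrightarrow> below p i l"
  by (induction rule: below.induct) (auto intro: below.intros)

text \<open>The edges of the smallest subtree containing \<open>X\<close>.\<close>

definition separating :: "(nat \<Rightarrow> nat) \<Rightarrow> nat \<Rightarrow> nat set \<Rightarrow> nat set" where
  "separating p m X = {i \<in> {1..m}. (\<exists>j\<in>X. below p i j) \<and> (\<exists>j\<in>X. \<not> below p i j)}"

text \<open>Moving the largest node \<open>i\<close> of \<open>X\<close> to its parent removes precisely the edge \<open>i\<close> from the
  separating edges: by maximality no other node of \<open>X\<close> is below \<open>i\<close>, and every other edge has \<open>i\<close>
  and \<open>p i\<close> on the same side. Reversing the move costs one walk from \<open>a (p i)\<close> to \<open>a i\<close>. The sum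
  of the indices decreases with each move, until \<open>X\<close> is a single node.\<close>

lemma tree_spanned:
  assumes G: "simple_graph V E"
    and p: "\<And>j. j > 0 \<Longrightarrow> p j < j"
    and aV: "\<And>i. i \<le> m \<Longrightarrow> a i \<in> V"
    and walk: "\<And>i. 0 < i \<Longrightarrow> i \<le> m \<Longrightarrow> (a (p i), a i) \<in> (adj_rel E)\<^sup>= ^^ l"
  shows "X \<subseteq> {..m} \<Longrightarrow> X \<noteq> {} \<Longrightarrow> spanned V E (a ` X) (l * card (separating p m X))"
proof (induction "\<Sum>X" arbitrary: X rule: less_induct)
  case less
  have fin: "finite X" using less.prems finite_subset by blast
  define i where "i = Max X"
  have iX: "i \<in> X" and imax: "\<And>j. j \<in> X \<Longrightarrow> j \<le> i"
    unfolding i_def using fin less.prems by auto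
  have im: "i \<le> m" using iX less.prems by auto
  show ?case
  proof (cases "X = {i}")
    case True
    then show ?thesis
      using spanned_mono[OF spanned_singleton[OF aV[OF im]]] by simp
  next
    case False
    then obtain j0 where j0: "j0 \<in> X" "j0 \<noteq> i" using iX by blast
    then have j0i: "j0 < i" using imax by fastforce
    then have i0: "i > 0" by simp
    define Y where "Y = insert (p i) (X - {i})"
    have below_i: "below p i j \<longleftrightarrow> j = i" if "j \<le> i" for j
      using below_le[OF p, where i = i and j = j] that by (auto intro: below.self)
    have "\<Sum>Y \<le> p i + \<Sum>(X - {i})"
      unfolding Y_def by (cases "p i \<in> X - {i}") (use fin in \<open>auto simp: insert_absorb\<close>)
    also have "\<dots> < i + \<Sum>(X - {i})" using p[OF i0] by simp
    also have "\<dots> = \<Sum>X" using fin iX by (simp add: sum.remove)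
    finally have smaller: "\<Sum>Y < \<Sum>X" .
    have YX: "Y \<subseteq> {..m}" "Y \<noteq> {}"
      using less.prems p[OF i0] im unfolding Y_def by auto
    have sep: "separating p m X = insert i (separating p m Y)"
    proof (rule set_eqI)
      fix q
      show "q \<in> separating p m X \<longleftrightarrow> q \<in> insert i (separating p m Y)"
      proof (cases "q = i")
        case True
        have "\<not> below p i j0" using below_i j0 j0i by simp
        then have "i \<in> separating p m X"
          using iX j0(1) im i0 below.self[of p i] unfolding separating_def by auto
        then show ?thesis using True by simp
      next
        case False
        have iff: "below p q i \<longleftrightarrow> below p q (p i)" by (rule below_parent_iff[OF i0 False])
        have X: "X = insert i (X - {i})" using iX by blast
        have "(\<exists>j\<in>X. P j) \<longleftrightarrow> P i \<or> (\<exists>j\<in>X - {i}. P j)" for P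
          by (subst X) blast
        then show ?thesis using False iff unfolding separating_def Y_def by simp
      qed
    qed
    have "\<not> below p i j" if "j \<in> Y" for j
      using that below_i[of j] imax[of j] p[OF i0] unfolding Y_def by auto
    then have "i \<notin> separating p m Y" unfolding separating_def by blast
    then have card: "card (separating p m X) = Suc (card (separating p m Y))"
      unfolding sep by (simp add: separating_def)
    have "spanned V E (insert (a i) (a ` Y)) (l * card (separating p m Y) + l)"
      using spanned_walk[OF G less.hyps[OF smaller YX] _ walk[OF i0 im]] unfolding Y_def by blast
    then show ?thesis
      by (rule spanned_mono) (auto simp: card Y_def)
  qed
qed

section \<open>Balanced edges of a weighted tree\<close>

lemma fibres_card_le:
  assumes "finite Y" "finite K"
    and fibre: "\<And>i. i \<in> K \<Longrightarrow> D \<le> card {v \<in> Y. \<pi> v = i}"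
  shows "D * card K \<le> card Y"
proof -
  have "D * card K = (\<Sum>i\<in>K. D)" by simp
  also have "\<dots> \<le> (\<Sum>i\<in>K. card {v \<in> Y. \<pi> v = i})" by (rule sum_mono) (rule fibre)
  also have "\<dots> = card (\<Union>i\<in>K. {v \<in> Y. \<pi> v = i})"
    using assms(1,2) by (subst card_UN_disjoint) auto
  also have "\<dots> \<le> card Y" using assms(1) by (intro card_mono) auto
  finally show ?thesis .
qed

text \<open>For nonempty \<open>I\<close>, consider the tree obtained by contracting every edge outside \<open>I\<close>. It has
  \<open>card I + 1\<close> nodes, each of weight at least \<open>D\<close>, and two of them are leaves of weight at least
  \<open>x\<close>. In terms of the original tree, one leaf is the subtree of the last edge \<open>i1\<close> of \<open>I\<close> below the
  first one \<open>i0\<close>. If all of \<open>I\<close> lies below \<open>i0\<close>, the root side of \<open>i0\<close> is the second leaf;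
  otherwise it is the subtree of the last edge \<open>i2\<close> of \<open>I\<close> not below \<open>i0\<close>.\<close>

lemma balanced_edges_bound:
  fixes D x :: nat and \<pi> :: "'a \<Rightarrow> nat"
  assumes p: "\<And>j. j > 0 \<Longrightarrow> p j < j"
    and V: "finite V"
    and fibre: "\<And>i. i \<le> m \<Longrightarrow> D \<le> card {v \<in> V. \<pi> v = i}"
    and x: "2 * x \<le> card V"
  defines "B \<equiv> \<lambda>i. {v \<in> V. below p i (\<pi> v)}"
  defines "I \<equiv> {i \<in> {1..m}. x \<le> card (B i) \<and> card (B i) \<le> card V - x}"
  shows "D * card I + 2 * x \<le> card V + D"
proof (cases "I = {}")
  case True
  show ?thesis unfolding True using x by simp
next
  case False
  have finI: "finite I" unfolding I_def by simp
  have BV: "B i \<subseteq> V" for i unfolding B_def by blast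
  have finB: "finite (B i)" for i using BV V finite_subset by blast
  have bI: "x \<le> card (B i)" "card (B i) \<le> card V - x" "0 < i" "i \<le> m" if "i \<in> I" for i
    using that unfolding I_def by auto
  \<comment> \<open>Two disjoint heavy parts of \<open>V\<close> that avoid the fibres over \<open>K\<close> leave room for these fibres.\<close>
  have room: "D * card K + 2 * x \<le> card V"
    if X: "X1 \<subseteq> V" "X2 \<subseteq> V" "X1 \<inter> X2 = {}" "x \<le> card X1" "x \<le> card X2"
      and K: "K \<subseteq> {..m}" "\<And>v. v \<in> X1 \<union> X2 \<Longrightarrow> \<pi> v \<notin> K" for X1 X2 K
  proof -
    have "D \<le> card {v \<in> V - (X1 \<union> X2). \<pi> v = i}" if "i \<in> K" for i
    proof -
      have "{v \<in> V - (X1 \<union> X2). \<pi> v = i} = {v \<in> V. \<pi> v = i}" using K(2) that by blast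
      then show ?thesis using fibre K(1) that by auto
    qed
    then have "D * card K \<le> card (V - (X1 \<union> X2))"
      using V K(1) finite_subset[OF K(1)] by (intro fibres_card_le[of _ _ _ \<pi>]) auto
    also have "\<dots> = card V - card (X1 \<union> X2)"
      using X(1,2) V by (intro card_Diff_subset) (auto intro: finite_subset)
    finally have "D * card K \<le> card V - (card X1 + card X2)"
      using X V by (subst (asm) card_Un_disjoint) (auto intro: finite_subset)
    moreover have "card X1 + card X2 \<le> card V"
      using X V by (subst card_Un_disjoint[symmetric]) (auto intro: finite_subset card_mono)
    ultimately show ?thesis using X(4,5) by linarith
  qed
  define i0 where "i0 = Min I"
  have i0: "i0 \<in> I" and i0min: "\<And>i. i \<in> I \<Longrightarrow> i0 \<le> i"
    unfolding i0_def using Min_in[OF finI False] Min_le[OF finI] by blast+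
  define I1 where "I1 = {i \<in> I. below p i0 i}"
  define I2 where "I2 = {i \<in> I. \<not> below p i0 i}"
  have fin12: "finite I1" "finite I2" unfolding I1_def I2_def using finI by auto
  have I1ne: "i0 \<in> I1" using i0 unfolding I1_def by (auto intro: below.self)
  define i1 where "i1 = Max I1"
  have i1: "i1 \<in> I1" and i1max: "\<And>i. i \<in> I1 \<Longrightarrow> i \<le> i1"
    unfolding i1_def using Max_in[OF fin12(1)] Max_ge[OF fin12(1)] I1ne by blast+
  have i1I: "i1 \<in> I" and i01: "below p i0 i1" using i1 unfolding I1_def by auto
  have only1: "i = i1" if "i \<in> I" "below p i1 i" for i
  proof -
    have "i \<in> I1" using that below_trans[OF that(2) i01] unfolding I1_def by blast
    then show ?thesis using i1max below_le[OF p that(2)] by fastforce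
  qed
  show ?thesis
  proof (cases "I2 = {}")
    case True
    have "D * card (I - {i1}) + 2 * x \<le> card V"
    proof (rule room)
      show "B i1 \<inter> (V - B i0) = {}"
        using below_trans[OF _ i01] unfolding B_def by blast
      have "card (V - B i0) = card V - card (B i0)" by (rule card_Diff_subset[OF finB BV])
      then show "x \<le> card (V - B i0)" using bI(2)[OF i0] x by linarith
      show "\<pi> v \<notin> I - {i1}" if "v \<in> B i1 \<union> (V - B i0)" for v
        using that True only1[of "\<pi> v"] unfolding B_def I2_def by blast
    qed (use BV bI(1,4) i1I in auto)
    moreover have "card I = Suc (card (I - {i1}))"
      using card.remove[OF finI i1I] .
    ultimately show ?thesis by (simp only: mult_Suc_right)
  next
    case False
    define i2 where "i2 = Max I2"
    have i2: "i2 \<in> I2" and i2max: "\<And>i. i \<in> I2 \<Longrightarrow> i \<le> i2"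
      unfolding i2_def using Max_in[OF fin12(2)] Max_ge[OF fin12(2)] False by blast+
    have i2I: "i2 \<in> I" and ni02: "\<not> below p i0 i2" using i2 unfolding I2_def by auto
    have apart: "\<not> below p i0 i" if "below p i2 i" for i
    proof
      assume "below p i0 i"
      then have "below p i2 i0" using below_linear that ni02 by blast
      then have "i2 = i0" using below_le[OF p] i0min[OF i2I] by fastforce
      then show False using ni02 below.self by blast
    qed
    have only2: "i = i2" if "i \<in> I" "below p i2 i" for i
    proof -
      have "i \<in> I2" using that apart unfolding I2_def by blast
      then show ?thesis using i2max below_le[OF p that(2)] by fastforce
    qed
    have ne: "i2 \<noteq> i1" using ni02 i01 by blast
    have zero: "\<not> below p i 0" if "i \<in> I" for i
      using below_le[OF p, of i 0] bI(3)[OF that] by auto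
    \<comment> \<open>The fibre over the root lies in neither subtree and makes up for the second edge left out.\<close>
    have "D * card (insert 0 (I - {i1} - {i2})) + 2 * x \<le> card V"
    proof (rule room)
      show "B i1 \<inter> B i2 = {}"
        using below_trans[OF _ i01] apart unfolding B_def by blast
      show "\<pi> v \<notin> insert 0 (I - {i1} - {i2})" if "v \<in> B i1 \<union> B i2" for v
      proof
        have heavy: "below p i1 (\<pi> v) \<or> below p i2 (\<pi> v)" using that unfolding B_def by blast
        assume "\<pi> v \<in> insert 0 (I - {i1} - {i2})"
        then consider "\<pi> v = 0" | "\<pi> v \<in> I" "\<pi> v \<noteq> i1" "\<pi> v \<noteq> i2" by auto
        then show False
        proof cases
          case 1
          then show False using heavy zero[OF i1I] zero[OF i2I] by simp
        next
          case 2
          then show False using heavy only1[OF 2(1)] only2[OF 2(1)] by blast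
        qed
      qed
    qed (use BV bI(1,4) i1I i2I ni02 i01 in auto)
    moreover have "card I = Suc (Suc (card (I - {i1} - {i2})))"
    proof -
      have "card (I - {i1}) = Suc (card (I - {i1} - {i2}))"
        by (rule card.remove) (use finI i2I ne in auto)
      then show ?thesis using card.remove[OF finI i1I] by linarith
    qed
    moreover have "card (insert 0 (I - {i1} - {i2})) = Suc (card (I - {i1} - {i2}))"
      using finI bI(3) by (intro card_insert_disjoint) auto
    ultimately show ?thesis by (simp only: mult_Suc_right)
  qed
qed

section \<open>Counting separated sets\<close>

text \<open>The number of \<open>k\<close>-subsets of an \<open>n\<close>-set that meet both a given \<open>w\<close>-subset and its complement
  (for \<open>k \<ge> 1\<close> and \<open>w \<le> n\<close>).\<close>

definition cut_count :: "nat \<Rightarrow> nat \<Rightarrow> nat \<Rightarrow> real" where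
  "cut_count n k w = real (n choose k) - real (w choose k) - real ((n - w) choose k)"

lemma card_separated_subsets:
  assumes V: "finite V" and B: "B \<subseteq> V" and k: "k \<ge> 1"
  shows "real (card {S. S \<subseteq> V \<and> card S = k \<and> S \<inter> B \<noteq> {} \<and> \<not> S \<subseteq> B})
           = cut_count (card V) k (card B)"
proof -
  let ?P = "\<lambda>A. {S. S \<subseteq> A \<and> card S = k}"
  let ?C = "{S. S \<subseteq> V \<and> card S = k \<and> S \<inter> B \<noteq> {} \<and> \<not> S \<subseteq> B}"
  have fin: "finite B" using V B finite_subset by blast
  have split: "?P V = ?C \<union> (?P B \<union> ?P (V - B))" using B by blast
  have "S \<noteq> {}" if "card S = k" for S :: "'a set" using that k by auto
  then have disj: "?P B \<inter> ?P (V - B) = {}" by blast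
  have disj2: "?C \<inter> (?P B \<union> ?P (V - B)) = {}" by blast
  have finP: "finite (?P A)" if "finite A" for A :: "'a set" using that by simp
  have "card (?P V) = card ?C + card (?P B \<union> ?P (V - B))"
    unfolding split by (rule card_Un_disjoint[OF _ _ disj2]) (use V fin in auto)
  also have "card (?P B \<union> ?P (V - B)) = card (?P B) + card (?P (V - B))"
    by (rule card_Un_disjoint[OF _ _ disj]) (use V fin in auto)
  finally have "card V choose k = card ?C + ((card B choose k) + ((card V - card B) choose k))"
    using V fin B by (simp add: n_subsets card_Diff_subset)
  then show ?thesis unfolding cut_count_def by linarith
qed

definition cut_diff :: "nat \<Rightarrow> nat \<Rightarrow> nat \<Rightarrow> real" where
  "cut_diff n k x = cut_count n k x - cut_count n k (x - 1)"

text \<open>By Pascal's rule the difference is \<open>((n - x) choose (k - 1)) - ((x - 1) choose (k - 1))\<close>.\<close>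

lemma cut_diff_nonneg:
  assumes "1 \<le> x" "2 * x \<le> n" "k \<ge> 1"
  shows "cut_diff n k x \<ge> 0"
proof -
  obtain y where y: "x = Suc y" using assms(1) by (cases x) auto
  obtain l where l: "k = Suc l" using assms(3) by (cases k) auto
  have n: "n - y = Suc (n - x)" using assms y by auto
  have "y choose l \<le> (n - x) choose l"
    by (rule binomial_right_mono) (use assms y in auto)
  then show ?thesis
    unfolding cut_diff_def cut_count_def by (simp add: y l n[unfolded y])
qed

text \<open>Layer-cake form of \<open>cut_count\<close>: for \<open>w \<le> n / 2\<close> the differences telescope from
  \<open>cut_count n k 0 = 0\<close>, and the general case follows by the symmetry \<open>w \<mapsto> n - w\<close>.\<close>

lemma cut_count_layers:
  assumes "w \<le> n" "k \<ge> 1"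
  shows "cut_count n k w = (\<Sum>x\<in>{1..n div 2}. cut_diff n k x * of_bool (x \<le> w \<and> w \<le> n - x))"
proof -
  have tele: "(\<Sum>x\<in>{1..s}. cut_diff n k x) = cut_count n k s" for s
  proof (induction s)
    case 0
    then show ?case using assms(2) by (simp add: cut_count_def binomial_eq_0)
  next
    case (Suc s)
    then show ?case by (simp add: cut_diff_def)
  qed
  define s where "s = min w (n - w)"
  have "(\<Sum>x\<in>{1..n div 2}. cut_diff n k x * of_bool (x \<le> w \<and> w \<le> n - x))
          = (\<Sum>x\<in>{1..s}. cut_diff n k x)"
    using assms(1) unfolding s_def by (intro sum.mono_neutral_cong_right) auto
  also have "\<dots> = cut_count n k s" by (rule tele)
  also have "\<dots> = cut_count n k w"
    unfolding s_def cut_count_def min_def using assms(1) by simp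
  finally show ?thesis by simp
qed

text \<open>The sum on the left is the Steiner Wiener index of a path on \<open>n\<close> vertices, whose \<open>j\<close>-th edge
  has \<open>j\<close> vertices on one side. The hockey-stick identity evaluates it.\<close>

lemma cut_count_sum:
  assumes "n \<ge> 1" "k \<ge> 1"
  shows "(\<Sum>j\<in>{1..n - 1}. cut_count n k j) = (real k - 1) / (real k + 1) * (real n + 1) * real (n choose k)"
proof -
  obtain N where N: "n = Suc N" using assms(1) by (cases n) auto
  have "(\<Sum>j\<le>N. j choose k) = Suc N choose Suc k"
    using sum_choose_upper[of k N] by (simp only: atMost_atLeast0)
  moreover have "(\<Sum>j\<le>N. j choose k) = (\<Sum>j\<in>{1..N}. j choose k)"
    using assms(2) by (intro sum.mono_neutral_right) (auto simp: binomial_eq_0 not_le)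
  ultimately have up: "(\<Sum>j\<in>{1..N}. j choose k) = n choose Suc k" using N by simp
  have "(\<Sum>j\<in>{1..N}. (n - j) choose k) = (\<Sum>j\<in>{1..N}. j choose k)"
    by (rule sum.reindex_bij_witness[of _ "\<lambda>j. n - j" "\<lambda>j. n - j"]) (auto simp: N)
  then have sum: "(\<Sum>j\<in>{1..n - 1}. cut_count n k j) = (real n - 1) * real (n choose k) - 2 * real (n choose Suc k)"
    using up unfolding cut_count_def
    by (simp add: sum_subtractf N of_nat_sum[symmetric] del: of_nat_sum binomial_Suc_Suc)
  have absorb: "real (n choose Suc k) * (real k + 1) = real (n choose k) * (real n - real k)"
  proof (cases "k \<le> n")
    case True
    have "Suc k * (n choose Suc k) = (n - k) * (n choose k)"
      by (simp only: binomial_absorb_comp binomial_absorption)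
    then have "real (Suc k * (n choose Suc k)) = real ((n - k) * (n choose k))" by presburger
    then show ?thesis using True by (simp add: of_nat_diff algebra_simps)
  qed (simp add: binomial_eq_0)
  have "((real n - 1) * real (n choose k) - 2 * real (n choose Suc k)) * (real k + 1)
      = (real k - 1) * (real n + 1) * real (n choose k)"
    using absorb by (simp add: algebra_simps)
  then show ?thesis unfolding sum by (simp add: field_simps)
qed

text \<open>Both the tree edges and the numbers \<open>1, \<dots>, n - 1\<close> are decomposed into layers. In layer \<open>x\<close>,
  \<open>D\<close> times the number of tree edges exceeds the number of integers in \<open>[x, n - x]\<close> by at most
  \<open>D - 1\<close>, and these excesses, weighted by the layer heights, add up to at most \<open>D - 1\<close> times the value of
  \<open>cut_count\<close> at \<open>n div 2\<close>.\<close>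

lemma weighted_tree_cut_bound:
  fixes \<pi> :: "'a \<Rightarrow> nat"
  assumes p: "\<And>j. j > 0 \<Longrightarrow> p j < j"
    and V: "finite V" "V \<noteq> {}"
    and fibre: "\<And>i. i \<le> m \<Longrightarrow> D \<le> card {v \<in> V. \<pi> v = i}"
    and D: "D \<ge> 1" and k: "k \<ge> 1" and n: "n = card V"
  defines "B \<equiv> \<lambda>i. {v \<in> V. below p i (\<pi> v)}"
  shows "real D * (\<Sum>i\<in>{1..m}. cut_count n k (card (B i)))
     \<le> (real k - 1) / (real k + 1) * (real n + 1) * real (n choose k) + (real D - 1) * real (n choose k)"
proof -
  let ?h = "n div 2"
  let ?M = "\<lambda>x. {i \<in> {1..m}. x \<le> card (B i) \<and> card (B i) \<le> n - x}"
  let ?J = "\<lambda>x. {j \<in> {1..n - 1}. x \<le> j \<and> j \<le> n - x}"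
  have n1: "n \<ge> 1" using V n by (simp add: Suc_le_eq card_gt_0_iff)
  have Bn: "card (B i) \<le> n" for i unfolding n B_def using V(1) by (intro card_mono) auto
  have layers: "(\<Sum>i\<in>A. cut_count n k (w i))
      = (\<Sum>x\<in>{1..?h}. cut_diff n k x * real (card {i \<in> A. x \<le> w i \<and> w i \<le> n - x}))"
    if "finite A" "\<And>i. i \<in> A \<Longrightarrow> w i \<le> n" for A :: "nat set" and w
  proof -
    have "(\<Sum>i\<in>A. cut_count n k (w i))
        = (\<Sum>i\<in>A. \<Sum>x\<in>{1..?h}. cut_diff n k x * of_bool (x \<le> w i \<and> w i \<le> n - x))"
      by (rule sum.cong[OF refl]) (rule cut_count_layers[OF that(2) k])
    also have "\<dots> = (\<Sum>x\<in>{1..?h}. \<Sum>i\<in>A. cut_diff n k x * of_bool (x \<le> w i \<and> w i \<le> n - x))"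
      by (rule sum.swap)
    also have "\<dots> = (\<Sum>x\<in>{1..?h}. cut_diff n k x * real (card {i \<in> A. x \<le> w i \<and> w i \<le> n - x}))"
      using that(1) by (simp add: sum_distrib_left[symmetric] sum_of_bool_eq Int_def)
    finally show ?thesis .
  qed
  have cmp: "real D * real (card (?M x)) \<le> real (card (?J x)) + (real D - 1)" if "x \<in> {1..?h}" for x
  proof -
    have x: "1 \<le> x" "2 * x \<le> n" using that by auto
    have "?J x = {x..n - x}" using x by auto
    then have "card (?J x) = Suc (n - x) - x" by simp
    moreover have "D * card (?M x) + 2 * x \<le> n + D"
      using balanced_edges_bound[OF p V(1) fibre, of m x] x(2) unfolding n B_def by blast
    then have "real (D * card (?M x) + 2 * x) \<le> real (n + D)" by (rule of_nat_mono)
    ultimately show ?thesis using x by (simp add: of_nat_diff)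
  qed
  have one: "(\<Sum>x\<in>{1..?h}. cut_diff n k x) = cut_count n k ?h"
    by (subst cut_count_layers[OF _ k]) (auto intro!: sum.cong)
  have "real D * (\<Sum>i\<in>{1..m}. cut_count n k (card (B i)))
      = (\<Sum>x\<in>{1..?h}. cut_diff n k x * (real D * real (card (?M x))))"
    by (subst layers) (use Bn in \<open>auto simp: sum_distrib_left mult_ac\<close>)
  also have "\<dots> \<le> (\<Sum>x\<in>{1..?h}. cut_diff n k x * (real (card (?J x)) + (real D - 1)))"
    by (intro sum_mono mult_left_mono cmp cut_diff_nonneg) (use k in auto)
  also have "\<dots> = (\<Sum>j\<in>{1..n - 1}. cut_count n k j) + (real D - 1) * cut_count n k ?h"
    by (subst layers)
      (auto simp: algebra_simps sum.distrib sum_subtractf sum_distrib_left[symmetric] one[symmetric])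
  also have "\<dots> \<le> (\<Sum>j\<in>{1..n - 1}. cut_count n k j) + (real D - 1) * real (n choose k)"
    using D by (intro add_left_mono mult_left_mono) (auto simp: cut_count_def)
  finally show ?thesis unfolding cut_count_sum[OF n1 k] .
qed

section \<open>Packing closed neighbourhoods\<close>

definition closed_nbhd :: "'a set set \<Rightarrow> 'a \<Rightarrow> 'a set" where
  "closed_nbhd E v = {u. (v, u) \<in> (adj_rel E)\<^sup>=}"

lemma closed_nbhd_sym: "u \<in> closed_nbhd E v \<longleftrightarrow> v \<in> closed_nbhd E u"
  by (auto simp: closed_nbhd_def adj_rel_def insert_commute)

lemma closed_nbhd_subset:
  "simple_graph V E \<Longrightarrow> v \<in> V \<Longrightarrow> closed_nbhd E v \<subseteq> V"
  by (auto simp: closed_nbhd_def adj_rel_def simple_graph_def)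

lemma card_closed_nbhd_ge:
  assumes G: "simple_graph V E" and v: "v \<in> V"
  shows "min_degree V E + 1 \<le> card (closed_nbhd E v)"
proof -
  have finV: "finite V" using G unfolding simple_graph_def by blast
  have fin: "finite (closed_nbhd E v)"
    using closed_nbhd_subset[OF G v] finV finite_subset by blast
  have "{e \<in> E. v \<in> e} \<subseteq> (\<lambda>u. {v, u}) ` (closed_nbhd E v - {v})"
  proof
    fix e assume e: "e \<in> {e \<in> E. v \<in> e}"
    then have "card e = 2" using G unfolding simple_graph_def by blast
    then obtain y z where yz: "e = {y, z}" "y \<noteq> z" by (auto simp: card_2_iff)
    then obtain u where "e = {v, u}" "u \<noteq> v" using e by auto
    then show "e \<in> (\<lambda>u. {v, u}) ` (closed_nbhd E v - {v})"
      using e by (auto simp: closed_nbhd_def adj_rel_def)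
  qed
  then have "card {e \<in> E. v \<in> e} \<le> card (closed_nbhd E v - {v})"
    using fin surj_card_le finite_Diff by metis
  moreover have "v \<in> closed_nbhd E v" by (simp add: closed_nbhd_def)
  then have "card (closed_nbhd E v) = Suc (card (closed_nbhd E v - {v}))"
    by (rule card.remove[OF fin])
  moreover have "min_degree V E \<le> vertex_degree E v"
    unfolding min_degree_def using finV v by simp
  ultimately show ?thesis unfolding vertex_degree_def by linarith
qed

text \<open>A packing of closed neighbourhoods together with the tree that links the centres. The condition
  on \<open>p\<close> extends to indices beyond \<open>m\<close> so that \<open>p\<close> is a parent function on all naturals.\<close>

definition nbhd_packing :: "'a set \<Rightarrow> 'a set set \<Rightarrow> (nat \<Rightarrow> 'a) \<Rightarrow> (nat \<Rightarrow> nat) \<Rightarrow> nat \<Rightarrow> bool" where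
  "nbhd_packing V E a p m \<longleftrightarrow>
     (\<forall>i\<le>m. a i \<in> V) \<and> (\<forall>j>0. p j < j) \<and>
     (\<forall>i\<le>m. \<forall>j\<le>m. i \<noteq> j \<longrightarrow> closed_nbhd E (a i) \<inter> closed_nbhd E (a j) = {}) \<and>
     (\<forall>i. 0 < i \<and> i \<le> m \<longrightarrow> (a (p i), a i) \<in> (adj_rel E)\<^sup>= ^^ 3)"

lemma connected_crossing_edge:
  assumes G: "connected_graph V E" and U: "U \<subseteq> V" "U \<noteq> {}" "U \<noteq> V"
  obtains u v where "u \<in> U" "v \<in> V - U" "(u, v) \<in> adj_rel E"
proof -
  obtain x y where xy: "x \<in> U" "y \<in> V - U" using U by blast
  then have "(x, y) \<in> (adj_rel E)\<^sup>*" using G U unfolding connected_graph_def by blast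
  then have "y \<in> U \<or> (\<exists>u\<in>U. \<exists>v\<in>V - U. (u, v) \<in> adj_rel E)"
  proof induction
    case base
    then show ?case using xy by blast
  next
    case (step y z)
    have "z \<in> V" using step(2) G
      unfolding connected_graph_def simple_graph_def adj_rel_def by auto
    then show ?case using step by blast
  qed
  then show ?thesis using that xy by blast
qed

text \<open>The given \<open>w\<close> may be far from all centres. But some edge \<open>u v\<close> leaves the set \<open>U\<close> of vertices
  whose closed neighbourhood meets a packed one; then \<open>v\<close> is the new centre, and a walk
  of length at most three leads to it from an old one, through an element common to the two
  closed neighbourhoods and through \<open>u\<close>.\<close>

lemma nbhd_packing_extend:
  assumes G: "connected_graph V E" and P: "nbhd_packing V E a p m"
    and w: "w \<in> V" "\<And>i. i \<le> m \<Longrightarrow> closed_nbhd E w \<inter> closed_nbhd E (a i) = {}"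
  shows "\<exists>a' p'. nbhd_packing V E a' p' (Suc m)"
proof -
  define U where "U = {v \<in> V. \<exists>i\<le>m. closed_nbhd E v \<inter> closed_nbhd E (a i) \<noteq> {}}"
  have "a 0 \<in> U" using P unfolding U_def nbhd_packing_def closed_nbhd_def by auto
  then obtain u v where uv: "u \<in> U" "v \<in> V - U" "(u, v) \<in> adj_rel E"
    using connected_crossing_edge[OF G, of U] w unfolding U_def by blast
  then obtain i z where i: "i \<le> m" and z: "z \<in> closed_nbhd E u" "z \<in> closed_nbhd E (a i)"
    unfolding U_def by blast
  have "(a i, z) \<in> (adj_rel E)\<^sup>=" "(z, u) \<in> (adj_rel E)\<^sup>=" "(u, v) \<in> (adj_rel E)\<^sup>="
    using z uv(3) closed_nbhd_sym[of z E u] unfolding closed_nbhd_def by auto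
  then have walk: "(a i, v) \<in> (adj_rel E)\<^sup>= ^^ 3"
    by (auto simp: numeral_3_eq_3 relcomp_unfold simp del: Un_iff)
  have "p j \<noteq> Suc m" if "0 < j" "j \<le> m" for j
  proof -
    have "p j < j" using P that(1) unfolding nbhd_packing_def by blast
    then show ?thesis using that(2) by simp
  qed
  then have "nbhd_packing V E (a(Suc m := v)) (p(Suc m := i)) (Suc m)"
    using P walk i uv(2) unfolding nbhd_packing_def U_def
    by (auto simp: le_Suc_eq Int_commute)
  then show ?thesis by blast
qed

text \<open>Hence a packing with the largest possible \<open>m\<close> exists.\<close>

lemma nbhd_packing_size:
  assumes V: "finite V" and P: "nbhd_packing V E a p m"
  shows "m < card V"
proof -
  have "inj_on a {..m}"
  proof (rule inj_onI, rule ccontr)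
    fix i j assume ij: "i \<in> {..m}" "j \<in> {..m}" "a i = a j" "i \<noteq> j"
    then have "closed_nbhd E (a i) \<inter> closed_nbhd E (a j) = {}"
      using P unfolding nbhd_packing_def by blast
    then show False using ij(3) by (auto simp: closed_nbhd_def)
  qed
  moreover have "a ` {..m} \<subseteq> V" using P unfolding nbhd_packing_def by auto
  ultimately have "card {..m} \<le> card V" using V card_inj_on_le by blast
  then show ?thesis by simp
qed

lemma maximal_nbhd_packing:
  assumes G: "connected_graph V E"
  obtains a p m where "nbhd_packing V E a p m"
    and "\<And>v. v \<in> V \<Longrightarrow> \<exists>i\<le>m. closed_nbhd E v \<inter> closed_nbhd E (a i) \<noteq> {}"
proof -
  let ?Q = "\<lambda>m. \<exists>a p. nbhd_packing V E a p m"
  have V: "finite V" "V \<noteq> {}" using G unfolding connected_graph_def simple_graph_def by blast+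
  then obtain v where "v \<in> V" by blast
  then have "nbhd_packing V E (\<lambda>_. v) (\<lambda>_. 0) 0" unfolding nbhd_packing_def by simp
  then have "?Q 0" by blast
  moreover have bound: "\<forall>m. ?Q m \<longrightarrow> m \<le> card V" using nbhd_packing_size[OF V(1)] by fastforce
  ultimately obtain m where m: "?Q m" "\<forall>l. ?Q l \<longrightarrow> l \<le> m"
    using GreatestI_nat[of ?Q 0 "card V"] Greatest_le_nat[of ?Q _ "card V"] by blast
  then obtain a p where P: "nbhd_packing V E a p m" by blast
  show ?thesis
  proof (rule that[OF P])
    fix v assume "v \<in> V"
    then show "\<exists>i\<le>m. closed_nbhd E v \<inter> closed_nbhd E (a i) \<noteq> {}"
      using nbhd_packing_extend[OF G P] m(2) not_less_eq_eq by blast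
  qed
qed

text \<open>A vertex in a packed neighbourhood goes to the centre of that neighbourhood, which makes the
  fibres large. Any other vertex goes to a centre with which it shares a neighbour.\<close>

lemma nbhd_packing_assignment:
  assumes P: "nbhd_packing V E a p m"
    and cover: "\<And>v. v \<in> V \<Longrightarrow> \<exists>i\<le>m. closed_nbhd E v \<inter> closed_nbhd E (a i) \<noteq> {}"
  obtains \<pi> where "\<And>v. v \<in> V \<Longrightarrow> \<pi> v \<le> m"
    and "\<And>v. v \<in> V \<Longrightarrow> (a (\<pi> v), v) \<in> (adj_rel E)\<^sup>= ^^ 2"
    and "\<And>v i. i \<le> m \<Longrightarrow> v \<in> closed_nbhd E (a i) \<Longrightarrow> \<pi> v = i"
proof -
  have "\<exists>i. (v \<in> V \<longrightarrow> i \<le> m \<and> (a i, v) \<in> (adj_rel E)\<^sup>= ^^ 2)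
      \<and> (\<forall>j\<le>m. v \<in> closed_nbhd E (a j) \<longrightarrow> i = j)" for v
  proof (cases "\<exists>i\<le>m. v \<in> closed_nbhd E (a i)")
    case True
    then obtain i where i: "i \<le> m" "v \<in> closed_nbhd E (a i)" by blast
    have "(a i, v) \<in> (adj_rel E)\<^sup>= ^^ 2"
      using i(2) by (auto simp: closed_nbhd_def numeral_2_eq_2 relcomp_unfold)
    moreover have "\<forall>j\<le>m. v \<in> closed_nbhd E (a j) \<longrightarrow> i = j"
      using P i unfolding nbhd_packing_def by blast
    ultimately show ?thesis using i(1) by blast
  next
    case False
    show ?thesis
    proof (cases "v \<in> V")
      case True
      then obtain i z where i: "i \<le> m" "z \<in> closed_nbhd E v" "z \<in> closed_nbhd E (a i)"
        using cover by blast
      have "(a i, z) \<in> (adj_rel E)\<^sup>=" "(z, v) \<in> (adj_rel E)\<^sup>="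
        using i(2,3) closed_nbhd_sym[of z E v] unfolding closed_nbhd_def by auto
      then have "(a i, v) \<in> (adj_rel E)\<^sup>= ^^ 2"
        by (auto simp: numeral_2_eq_2 relcomp_unfold simp del: Un_iff)
      then show ?thesis using False i(1) by blast
    qed (use False in blast)
  qed
  then obtain \<pi> where "\<And>v. (v \<in> V \<longrightarrow> \<pi> v \<le> m \<and> (a (\<pi> v), v) \<in> (adj_rel E)\<^sup>= ^^ 2)
      \<and> (\<forall>j\<le>m. v \<in> closed_nbhd E (a j) \<longrightarrow> \<pi> v = j)"
    by metis
  then show ?thesis using that by blast
qed

section \<open>The bound on the Steiner Wiener index\<close>

text \<open>Double counting of the pairs of a \<open>k\<close>-set \<open>S\<close> and a tree edge separating \<open>\<pi> ` S\<close>.\<close>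

lemma steiner_wiener_le_cuts:
  fixes \<pi> :: "'a \<Rightarrow> nat"
  assumes G: "simple_graph V E" and k: "k \<ge> 1"
    and p: "\<And>j. j > 0 \<Longrightarrow> p j < j"
    and aV: "\<And>i. i \<le> m \<Longrightarrow> a i \<in> V"
    and walk: "\<And>i. 0 < i \<Longrightarrow> i \<le> m \<Longrightarrow> (a (p i), a i) \<in> (adj_rel E)\<^sup>= ^^ l"
    and \<pi>: "\<And>v. v \<in> V \<Longrightarrow> \<pi> v \<le> m"
    and near: "\<And>v. v \<in> V \<Longrightarrow> (a (\<pi> v), v) \<in> (adj_rel E)\<^sup>= ^^ r"
  defines "B \<equiv> \<lambda>i. {v \<in> V. below p i (\<pi> v)}"
  shows "real (steiner_wiener k V E)
     \<le> real l * (\<Sum>i\<in>{1..m}. cut_count (card V) k (card (B i))) + real r * real k * real (card V choose k)"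
proof -
  let ?K = "{S. S \<subseteq> V \<and> card S = k}"
  have V: "finite V" using G unfolding simple_graph_def by blast
  have finK: "finite ?K" using V by simp
  have dist: "steiner_distance V E S \<le> l * (\<Sum>i\<in>{1..m}. of_bool (S \<inter> B i \<noteq> {} \<and> \<not> S \<subseteq> B i)) + r * k"
    if S: "S \<in> ?K" for S
  proof -
    have SV: "S \<subseteq> V" "card S = k" "S \<noteq> {}" "finite S"
      using S k V by (auto intro: finite_subset)
    have "spanned V E (a ` \<pi> ` S) (l * card (separating p m (\<pi> ` S)))"
      by (rule tree_spanned[where a = a, OF G p aV walk]) (use SV \<pi> in auto)
    then have "spanned V E (a ` \<pi> ` S \<union> S) (l * card (separating p m (\<pi> ` S)) + r * card S)"
      by (rule spanned_attach[OF G]) (use SV near in auto)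
    then have "spanned V E S (l * card (separating p m (\<pi> ` S)) + r * card S)"
      by (rule spanned_mono) auto
    then have "steiner_distance V E S \<le> l * card (separating p m (\<pi> ` S)) + r * k"
      using steiner_distance_le SV(2) by blast
    moreover have "separating p m (\<pi> ` S) = {i \<in> {1..m}. S \<inter> B i \<noteq> {} \<and> \<not> S \<subseteq> B i}"
      using SV(1) unfolding separating_def B_def by auto
    ultimately show ?thesis by (simp add: sum_of_bool_eq Int_def)
  qed
  have cut: "(\<Sum>S\<in>?K. of_bool (S \<inter> B i \<noteq> {} \<and> \<not> S \<subseteq> B i)) = cut_count (card V) k (card (B i))" for i
  proof -
    have "(\<Sum>S\<in>?K. of_bool (S \<inter> B i \<noteq> {} \<and> \<not> S \<subseteq> B i))
        = real (card {S. S \<subseteq> V \<and> card S = k \<and> S \<inter> B i \<noteq> {} \<and> \<not> S \<subseteq> B i})"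
      using finK by (simp add: sum_of_bool_eq Int_def conj_assoc)
    also have "\<dots> = cut_count (card V) k (card (B i))"
      by (rule card_separated_subsets[OF V _ k]) (auto simp: B_def)
    finally show ?thesis .
  qed
  have "steiner_wiener k V E
      \<le> (\<Sum>S\<in>?K. l * (\<Sum>i\<in>{1..m}. of_bool (S \<inter> B i \<noteq> {} \<and> \<not> S \<subseteq> B i)) + r * k)"
    unfolding steiner_wiener_def by (rule sum_mono) (rule dist)
  then have "real (steiner_wiener k V E)
      \<le> real (\<Sum>S\<in>?K. l * (\<Sum>i\<in>{1..m}. of_bool (S \<inter> B i \<noteq> {} \<and> \<not> S \<subseteq> B i)) + r * k)"
    by (rule of_nat_mono)
  also have "\<dots> = (\<Sum>S\<in>?K. real l * (\<Sum>i\<in>{1..m}. of_bool (S \<inter> B i \<noteq> {} \<and> \<not> S \<subseteq> B i)))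
      + real r * real k * real (card V choose k)"
    using V by (simp add: sum.distrib n_subsets del: sum_of_bool_eq)
  also have "(\<Sum>S\<in>?K. real l * (\<Sum>i\<in>{1..m}. of_bool (S \<inter> B i \<noteq> {} \<and> \<not> S \<subseteq> B i)))
      = real l * (\<Sum>i\<in>{1..m}. \<Sum>S\<in>?K. of_bool (S \<inter> B i \<noteq> {} \<and> \<not> S \<subseteq> B i))"
    unfolding sum_distrib_left[symmetric] by (subst sum.swap) (rule refl)
  finally show ?thesis unfolding cut .
qed

theorem corollary1:
  fixes V :: "'a set" and E :: "'a set set" and k n \<delta> :: nat
  assumes "k \<ge> 1"
    and "connected_graph V E"
    and "card V = n"
    and "min_degree V E = \<delta>"
  shows "(real (steiner_wiener k V E)
           \<le> (real k - 1) / (real k + 1) * (3 * (real n + 1) / (real \<delta> + 1)) * real (n choose k)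
             + (3 * real \<delta> / (real \<delta> + 1) + 2 * real k) * real (n choose k))
         \<and> (k \<le> n \<longrightarrow> avg_steiner_distance k V E
           \<le> (real k - 1) / (real k + 1) * (3 * (real n + 1) / (real \<delta> + 1))
             + 3 * real \<delta> / (real \<delta> + 1) + 2 * real k)"
proof -
  have G: "simple_graph V E" and V: "finite V" "V \<noteq> {}"
    using assms(2) unfolding connected_graph_def simple_graph_def by blast+
  obtain a p m where P: "nbhd_packing V E a p m"
    and cover: "\<And>v. v \<in> V \<Longrightarrow> \<exists>i\<le>m. closed_nbhd E v \<inter> closed_nbhd E (a i) \<noteq> {}"
    using maximal_nbhd_packing[OF assms(2)] by blast
  obtain \<pi> where \<pi>: "\<And>v. v \<in> V \<Longrightarrow> \<pi> v \<le> m"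
    and near: "\<And>v. v \<in> V \<Longrightarrow> (a (\<pi> v), v) \<in> (adj_rel E)\<^sup>= ^^ 2"
    and own: "\<And>v i. i \<le> m \<Longrightarrow> v \<in> closed_nbhd E (a i) \<Longrightarrow> \<pi> v = i"
    using nbhd_packing_assignment[OF P cover] by blast
  have p: "\<And>j. j > 0 \<Longrightarrow> p j < j" and aV: "\<And>i. i \<le> m \<Longrightarrow> a i \<in> V"
    and walk: "\<And>i. 0 < i \<Longrightarrow> i \<le> m \<Longrightarrow> (a (p i), a i) \<in> (adj_rel E)\<^sup>= ^^ 3"
    using P unfolding nbhd_packing_def by blast+
  have fibre: "\<delta> + 1 \<le> card {v \<in> V. \<pi> v = i}" if "i \<le> m" for i
  proof -
    have "\<delta> + 1 \<le> card (closed_nbhd E (a i))"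
      using card_closed_nbhd_ge[OF G aV[OF that]] assms(4) by simp
    also have "\<dots> \<le> card {v \<in> V. \<pi> v = i}"
      using own[OF that] closed_nbhd_subset[OF G aV[OF that]] V(1) by (intro card_mono) auto
    finally show ?thesis .
  qed
  let ?c = "\<Sum>i\<in>{1..m}. cut_count n k (card {v \<in> V. below p i (\<pi> v)})"
  let ?N = "real (n choose k)"
  let ?A = "(real k - 1) / (real k + 1)"
  let ?b = "?A * (3 * (real n + 1) / (real \<delta> + 1)) + 3 * real \<delta> / (real \<delta> + 1) + 2 * real k"
  have "real (\<delta> + 1) * ?c \<le> ?A * (real n + 1) * ?N + (real (\<delta> + 1) - 1) * ?N"
    by (rule weighted_tree_cut_bound[OF p V fibre _ assms(1) assms(3)[symmetric]]) auto
  then have "?c \<le> (?A * (real n + 1) * ?N + real \<delta> * ?N) / (real \<delta> + 1)"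
    by (subst pos_le_divide_eq) (auto simp: mult.commute add.commute)
  moreover have "real (steiner_wiener k V E) \<le> 3 * ?c + 2 * real k * ?N"
    using steiner_wiener_le_cuts[OF G assms(1) p aV walk \<pi> near] assms(3) by simp
  ultimately have "real (steiner_wiener k V E)
      \<le> 3 * ((?A * (real n + 1) * ?N + real \<delta> * ?N) / (real \<delta> + 1)) + 2 * real k * ?N"
    by linarith
  also have "\<dots> = ?b * ?N"
    by (simp add: add_divide_distrib diff_divide_distrib algebra_simps)
  finally have main: "real (steiner_wiener k V E) \<le> ?b * ?N" .
  have "avg_steiner_distance k V E \<le> ?b" if "k \<le> n"
    using main that assms(3) unfolding avg_steiner_distance_def
    by (subst pos_divide_le_eq) auto
  then show ?thesis using main by (simp add: distrib_right)
qed

end
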